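(* Let $n,m$ be coprime positive integers and let $M\in\mathcal{M}(n,m)$. Then $M$ is extremal if and only if $M$ is minimum. That is, $M$ is extremal if and only if $|\operatorname{supp} M| = n+m-1$.
   Context: For positive integers $n,m$, an $n\times m$ real array $A=(a_{i,j})$ with all $a_{i,j}\ge 0$ is called doubly stochastic (with uniform marginals) if $\sum_{i=1}^n a_{i,j}=n$ for every column $j=1,\dots,m$ and $\sum_{j=1}^m a_{i,j}=m$ for every row $i=1,\dots,n$. The set of all such arrays is denoted $\mathcal{M}(n,m)$; it is a convex set. An array $M\in\mathcal{M}(n,m)$ is extremal if it is an extreme point of the convex set $\mathcal{M}(n,m)$, i.e. it cannot be written as a convex combination of elements of $\mathcal{M}(n,m)$ different from $M$. The support $\operatorname{supp} A$ is the set of positions $(i,j)$ with $a_{i,j}\neq 0$, and $|\operatorname{supp} A|$ is its cardinality. Define $S(n,m)=\min\{|\operatorname{supp} A| : A\in\mathcal{M}(n,m)\}$. An array $M\in\mathcal{M}(n,m)$ is called minimum if $|\operatorname{supp} M|=S(n,m)$. *)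

theory Defs
  imports "HOL-Analysis.Analysis"
begin

text \<open>
  An \<open>n \<times> m\<close> real array is an element of \<open>real ^ 'm ^ 'n\<close>, where \<open>n = CARD('n)\<close> and
  \<open>m = CARD('m)\<close>; the entry in row \<open>i\<close> and column \<open>j\<close> is \<open>A $ i $ j\<close>. Every column sums to \<open>n\<close>
  and every row sums to \<open>m\<close>.
\<close>

definition doubly_stochastic :: "(real ^ 'm ^ 'n) set" where
  "doubly_stochastic =
     {A. (\<forall>i j. 0 \<le> A $ i $ j) \<and>
         (\<forall>j. (\<Sum>i\<in>UNIV. A $ i $ j) = real CARD('n)) \<and>
         (\<forall>i. (\<Sum>j\<in>UNIV. A $ i $ j) = real CARD('m))}"

definition supp :: "real ^ 'm ^ 'n \<Rightarrow> ('n \<times> 'm) set" where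
  "supp A = {(i, j). A $ i $ j \<noteq> 0}"

text \<open>
  The type arguments \<open>TYPE('n)\<close> and \<open>TYPE('m)\<close> carry the dimensions \<open>n\<close> and \<open>m\<close>. The set under
  \<open>Min\<close> is finite and nonempty by the two lemmas that follow the definition.
\<close>

definition min_supp :: "'n::finite itself \<Rightarrow> 'm::finite itself \<Rightarrow> nat" where
  "min_supp _ _ = Min ((\<lambda>A. card (supp A)) ` (doubly_stochastic :: (real ^ 'm ^ 'n) set))"

lemma finite_card_supp_image:
  "finite ((\<lambda>A. card (supp A)) ` (doubly_stochastic :: (real ^ 'm ^ 'n) set))"
proof (rule finite_subset)
  show "(\<lambda>A. card (supp A)) ` (doubly_stochastic :: (real ^ 'm ^ 'n) set)
          \<subseteq> {..card (UNIV :: ('n \<times> 'm) set)}"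
    by (auto intro!: card_mono simp del: card_prod)
qed simp

lemma doubly_stochastic_nonempty: "(doubly_stochastic :: (real ^ 'm ^ 'n) set) \<noteq> {}"
proof -
  have "(\<chi> i j. 1) \<in> (doubly_stochastic :: (real ^ 'm ^ 'n) set)"
    by (simp add: doubly_stochastic_def)
  then show ?thesis by blast
qed

definition extremal :: "real ^ 'm ^ 'n \<Rightarrow> bool" where
  "extremal M \<longleftrightarrow> M extreme_point_of doubly_stochastic"

definition minimum :: "real ^ 'm ^ 'n \<Rightarrow> bool" where
  "minimum M \<longleftrightarrow> M \<in> doubly_stochastic \<and> card (supp M) = min_supp TYPE('n) TYPE('m)"

end

theory Submission
  imports Defs
begin

text \<open>
  View the support of an array as the edge set of a bipartite graph between the \<open>n\<close> rows and the
  \<open>m\<close> columns. Two linear systems attached to this edge set decide everything.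

  The first has the edges as unknowns and the marginals as equations: a nonzero solution is a
  perturbation \<open>D\<close> with zero marginals that lives on the support of \<open>M\<close>. One can walk from \<open>M\<close>
  along \<open>D\<close> and along \<open>-D\<close> until an entry vanishes, so \<open>M\<close> is extremal exactly when there is no
  such \<open>D\<close> (\<open>extremal_iff_no_perturbation\<close>), and if there is one, then some doubly stochastic array
  has strictly smaller support (\<open>shrink_support_along\<close>). There are only \<open>n + m - 1\<close> independent
  equations, since the rows and the columns have the same total; hence a larger support always
  carries a perturbation (\<open>perturbation_exists\<close>).

  The second system is dual: the unknowns are potentials on rows and columns, and each edge
  demands that the potentials of its ends add up to zero. A level set of a solution is a set \<open>R\<close> of
  rows and a set \<open>C\<close> of columns such that no edge leaves \<open>R \<union> C\<close>. Counting the mass in such a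
  block by rows and by columns gives \<open>|R| m = |C| n\<close>, and coprimality leaves only the empty and the
  full block: the graph is connected. So a solution is determined by its value at one row, which
  forces at least \<open>n + m - 1\<close> edges (\<open>card_supp_ge\<close>).

  Together: an extremal array has at most, hence exactly, \<open>n + m - 1\<close> nonzero entries, and an
  array with \<open>n + m - 1\<close> nonzero entries admits no perturbation, because shrinking its support
  would violate the lower bound. The same shrinking shows that the minimum support size attains
  the bound.
\<close>

section \<open>Underdetermined linear systems\<close>

text \<open>Gaussian elimination of one equation per step, on arbitrary finite index sets, so that it
  serves both for unknowns on edges and for unknowns on vertices.\<close>

lemma underdetermined_homogeneous_system:
  fixes c :: "'e \<Rightarrow> 'v \<Rightarrow> 'a::field"
  assumes "finite E" "finite V" "card E < card V"
  shows "\<exists>x. (\<exists>v\<in>V. x v \<noteq> 0) \<and> (\<forall>e\<in>E. (\<Sum>v\<in>V. c e v * x v) = 0)"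
  using assms
proof (induction E arbitrary: V c rule: finite_induct)
  case empty
  then obtain w where "w \<in> V" by fastforce
  then show ?case by (auto intro!: exI[of _ "\<lambda>_. 1"])
next
  case (insert e E)
  show ?case
  proof (cases "\<forall>v\<in>V. c e v = 0")
    case True
    have "card E < card V" using insert by simp
    from insert.IH[OF \<open>finite V\<close> this, of c] True show ?thesis by auto
  next
    case False
    then obtain w where w: "w \<in> V" "c e w \<noteq> 0" by blast
    let ?V = "V - {w}"
    have "card E < card ?V" using insert w by (simp add: card_Diff_singleton)
    from insert.IH[OF _ this, of "\<lambda>e' v. c e' v - c e' w / c e w * c e v"] \<open>finite V\<close>
    obtain x where x: "\<exists>v\<in>?V. x v \<noteq> 0"
      and eqs: "\<And>e'. e' \<in> E \<Longrightarrow> (\<Sum>v\<in>?V. (c e' v - c e' w / c e w * c e v) * x v) = 0"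
      by auto
    define s where "s = (\<Sum>v\<in>?V. c e v * x v)"
    define y where "y = x(w := - s / c e w)"
    have sum_y: "(\<Sum>v\<in>V. c e' v * y v) = (\<Sum>v\<in>?V. c e' v * x v) - c e' w / c e w * s" for e'
    proof -
      have "(\<Sum>v\<in>?V. c e' v * y v) = (\<Sum>v\<in>?V. c e' v * x v)"
        by (rule sum.cong) (auto simp: y_def)
      then show ?thesis
        using sum.remove[OF \<open>finite V\<close> w(1), of "\<lambda>v. c e' v * y v"] by (simp add: y_def)
    qed
    have "(\<Sum>v\<in>V. c e v * y v) = 0" using sum_y[of e] w by (simp add: s_def)
    moreover have "(\<Sum>v\<in>V. c e' v * y v) = 0" if "e' \<in> E" for e'
      using eqs[OF that] unfolding sum_y s_def
      by (simp add: left_diff_distrib sum_subtractf sum_distrib_left mult.assoc)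
    moreover have "\<exists>v\<in>V. y v \<noteq> 0" using x by (auto simp: y_def)
    ultimately show ?thesis by (intro exI[of _ y]) auto
  qed
qed

section \<open>Perturbations on the support\<close>

definition zero_marginals :: "(real ^ 'm ^ 'n) set" where
  "zero_marginals =
     {D. (\<forall>j. (\<Sum>i\<in>UNIV. D $ i $ j) = 0) \<and> (\<forall>i. (\<Sum>j\<in>UNIV. D $ i $ j) = 0)}"

lemma uminus_zero_marginals: "D \<in> zero_marginals \<Longrightarrow> - D \<in> zero_marginals"
  by (simp add: zero_marginals_def sum_negf)

lemma supp_uminus [simp]: "supp (- D) = supp D"
  by (simp add: supp_def)

text \<open>Walking along \<open>D\<close>, the first entry to become negative is one with \<open>D\<close> negative and with the
  smallest ratio to \<open>-D\<close>; stopping there makes that entry zero.\<close>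

lemma shrink_support_along:
  assumes A: "A \<in> doubly_stochastic" and D: "D \<in> zero_marginals" "D \<noteq> 0" "supp D \<subseteq> supp A"
  obtains t where "t > 0" "A + t *\<^sub>R D \<in> doubly_stochastic" "supp (A + t *\<^sub>R D) \<subset> supp A"
proof -
  define N where "N = {(i, j). D $ i $ j < 0}"
  define r where "r = (\<lambda>(i, j). A $ i $ j / - D $ i $ j)"
  have nonneg: "0 \<le> A $ i $ j" for i j using A by (simp add: doubly_stochastic_def)
  have zero: "D $ i $ j = 0" if "A $ i $ j = 0" for i j using D(3) that by (force simp: supp_def)
  have "N \<noteq> {}"
  proof
    assume "N = {}"
    then have "(i, j) \<notin> N" for i j by simp
    then have "0 \<le> D $ i $ j" for i j by (simp add: N_def not_less)
    with D(1) have "D $ i $ j = 0" for i j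
      by (simp add: zero_marginals_def sum_nonneg_eq_0_iff)
    with D(2) show False by (simp add: vec_eq_iff)
  qed
  define t where "t = Min (r ` N)"
  from \<open>N \<noteq> {}\<close> have "t \<in> r ` N" unfolding t_def by (intro Min_in) auto
  then obtain i0 j0 where neg: "D $ i0 $ j0 < 0" and t: "t = A $ i0 $ j0 / - D $ i0 $ j0"
    by (auto simp: r_def N_def)
  have in_supp: "A $ i0 $ j0 \<noteq> 0" using zero[of i0 j0] neg by auto
  then have "t > 0" using neg nonneg[of i0 j0] by (simp add: t divide_pos_neg)
  have ge: "0 \<le> A $ i $ j + t * D $ i $ j" for i j
  proof (cases "D $ i $ j < 0")
    case True
    then have "t \<le> r (i, j)" unfolding t_def by (intro Min_le) (auto simp: N_def)
    with True have "t * - D $ i $ j \<le> A $ i $ j"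
      unfolding r_def split by (subst (asm) pos_le_divide_eq) auto
    then show ?thesis by simp
  next
    case False
    then show ?thesis using \<open>t > 0\<close> nonneg[of i j] by simp
  qed
  have "A + t *\<^sub>R D \<in> doubly_stochastic"
    using A D(1) ge
    by (simp add: doubly_stochastic_def zero_marginals_def sum.distrib flip: sum_distrib_left)
  moreover have "supp (A + t *\<^sub>R D) \<subseteq> supp A" using zero by (auto simp: supp_def)
  moreover have "(i0, j0) \<in> supp A" "(i0, j0) \<notin> supp (A + t *\<^sub>R D)"
    using in_supp neg by (auto simp: supp_def t)
  ultimately show thesis using that[OF \<open>t > 0\<close>] by blast
qed

text \<open>A segment of doubly stochastic arrays around \<open>M\<close> cannot leave the support of \<open>M\<close>, because
  entries are nonnegative: a zero of \<open>M\<close> is a zero of both ends. So its direction is a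
  perturbation on the support, and conversely a perturbation gives a segment.\<close>

lemma extremal_iff_no_perturbation:
  fixes M :: "real ^ 'm ^ 'n"
  assumes M: "M \<in> doubly_stochastic"
  shows "extremal M \<longleftrightarrow> \<not> (\<exists>D\<in>zero_marginals. D \<noteq> 0 \<and> supp D \<subseteq> supp M)"
proof
  assume ext: "extremal M"
  show "\<not> (\<exists>D\<in>zero_marginals. D \<noteq> 0 \<and> supp D \<subseteq> supp M)"
  proof
    assume "\<exists>D\<in>zero_marginals. D \<noteq> 0 \<and> supp D \<subseteq> supp M"
    then obtain D where D: "D \<in> zero_marginals" "D \<noteq> 0" "supp D \<subseteq> supp M" by blast
    obtain t where t: "t > 0" "M + t *\<^sub>R D \<in> doubly_stochastic"
      using shrink_support_along[OF M D] .
    have "- D \<noteq> 0" "supp (- D) \<subseteq> supp M" using D by simp_all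
    from shrink_support_along[OF M uminus_zero_marginals[OF D(1)] this]
    obtain s where s: "s > 0" "M + s *\<^sub>R (- D) \<in> doubly_stochastic" .
    define u where "u = t / (t + s)"
    have u: "0 < u" "u < 1" "u * s = (1 - u) * t" using s t by (simp_all add: u_def field_simps)
    have "(1 - u) *\<^sub>R (M + t *\<^sub>R D) + u *\<^sub>R (M + s *\<^sub>R (- D))
        = M + ((1 - u) * t - u * s) *\<^sub>R D"
      by (simp add: algebra_simps)
    then have "M = (1 - u) *\<^sub>R (M + t *\<^sub>R D) + u *\<^sub>R (M + s *\<^sub>R (- D))"
      using u by simp
    moreover have "M + t *\<^sub>R D \<noteq> M + s *\<^sub>R (- D)"
    proof
      assume "M + t *\<^sub>R D = M + s *\<^sub>R (- D)"
      then have "(t + s) *\<^sub>R D = 0" by (simp add: algebra_simps)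
      with s t D(2) show False by simp
    qed
    ultimately have "M \<in> open_segment (M + t *\<^sub>R D) (M + s *\<^sub>R (- D))"
      using u by (auto simp: in_segment)
    with ext s t show False by (auto simp: extremal_def extreme_point_of_def)
  qed
next
  assume none: "\<not> (\<exists>D\<in>zero_marginals. D \<noteq> 0 \<and> supp D \<subseteq> supp M)"
  show "extremal M"
    unfolding extremal_def extreme_point_of_def
  proof (intro conjI ballI notI)
    fix A B :: "real ^ 'm ^ 'n"
    assume A: "A \<in> doubly_stochastic" and B: "B \<in> doubly_stochastic"
      and "M \<in> open_segment A B"
    then obtain u where u: "0 < u" "u < 1" "M = (1 - u) *\<^sub>R A + u *\<^sub>R B" and "A \<noteq> B"
      by (auto simp: in_segment)
    have "A - B \<in> zero_marginals"
      using A B by (simp add: doubly_stochastic_def zero_marginals_def sum_subtractf)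
    moreover have "A $ i $ j = B $ i $ j" if "M $ i $ j = 0" for i j
    proof -
      have "0 \<le> A $ i $ j" "0 \<le> B $ i $ j" using A B by (auto simp: doubly_stochastic_def)
      moreover have "(1 - u) * A $ i $ j + u * B $ i $ j = 0" using that u by simp
      ultimately show ?thesis using u by (simp add: add_nonneg_eq_0_iff)
    qed
    then have "supp (A - B) \<subseteq> supp M" by (auto simp: supp_def)
    ultimately show False using none \<open>A \<noteq> B\<close> by auto
  qed (rule M)
qed

text \<open>One column equation may be dropped: the other equations make the total of all entries, and
  hence the total of the dropped column, equal to zero. This is what gains the \<open>- 1\<close>.\<close>

lemma perturbation_exists:
  fixes S :: "('n::finite \<times> 'm::finite) set"
  assumes "card S > CARD('n) + CARD('m) - 1"
  shows "\<exists>D\<in>zero_marginals. D \<noteq> (0 :: real ^ 'm ^ 'n) \<and> supp D \<subseteq> S"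
proof -
  obtain j0 :: 'm where True by simp
  define E :: "('n + 'm) set" where "E = UNIV - {Inr j0}"
  define c :: "'n + 'm \<Rightarrow> 'n \<times> 'm \<Rightarrow> real" where
    "c e p = (case e of Inl i \<Rightarrow> of_bool (fst p = i) | Inr j \<Rightarrow> of_bool (snd p = j))" for e p
  have "card E < card S"
    using assms by (simp add: E_def card_Diff_singleton)
  from underdetermined_homogeneous_system[OF _ _ this, of c]
  obtain x where x: "\<exists>p\<in>S. x p \<noteq> 0" and eqs: "\<And>e. e \<in> E \<Longrightarrow> (\<Sum>p\<in>S. c e p * x p) = 0"
    by auto
  define D :: "real ^ 'm ^ 'n" where "D = (\<chi> i j. of_bool ((i, j) \<in> S) * x (i, j))"
  have eq_sum: "(\<Sum>p\<in>S. c e p * x p) = (\<Sum>i\<in>UNIV. \<Sum>j\<in>UNIV. c e (i, j) * D $ i $ j)" for e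
  proof -
    have "(\<Sum>p\<in>S. c e p * x p) = (\<Sum>p\<in>UNIV. c e p * (of_bool (p \<in> S) * x p))"
      by (rule sum.mono_neutral_cong_left) auto
    also have "\<dots> = (\<Sum>i\<in>UNIV. \<Sum>j\<in>UNIV. c e (i, j) * D $ i $ j)"
      by (simp add: D_def sum.cartesian_product split_def)
    finally show ?thesis .
  qed
  have row: "(\<Sum>j\<in>UNIV. D $ i $ j) = 0" for i
  proof -
    have "(\<Sum>j\<in>UNIV. c (Inl i) (i', j) * D $ i' $ j)
        = (if i' = i then \<Sum>j\<in>UNIV. D $ i $ j else 0)" for i'
      by (simp add: c_def)
    then show ?thesis using eqs[of "Inl i"] by (simp add: eq_sum E_def)
  qed
  have col_other: "(\<Sum>i\<in>UNIV. D $ i $ j) = 0" if "j \<noteq> j0" for j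
  proof -
    have "(\<Sum>j'\<in>UNIV. c (Inr j) (i, j') * D $ i $ j') = D $ i $ j" for i
      by (simp add: c_def of_bool_def if_distrib[of "\<lambda>z. z * _"] cong: if_cong)
    then show ?thesis using eqs[of "Inr j"] that by (simp add: eq_sum E_def)
  qed
  have "(\<Sum>j\<in>UNIV. \<Sum>i\<in>UNIV. D $ i $ j) = (\<Sum>i\<in>UNIV. \<Sum>j\<in>UNIV. D $ i $ j)"
    by (rule sum.swap)
  also have "\<dots> = 0" by (simp add: row)
  also have "(\<Sum>j\<in>UNIV. \<Sum>i\<in>UNIV. D $ i $ j) = (\<Sum>i\<in>UNIV. D $ i $ j0)"
    using sum.remove[of UNIV j0 "\<lambda>j. \<Sum>i\<in>UNIV. D $ i $ j"] by (simp add: col_other)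
  finally have "(\<Sum>i\<in>UNIV. D $ i $ j) = 0" for j using col_other by (cases "j = j0") auto
  then have "D \<in> zero_marginals" by (simp add: zero_marginals_def row)
  moreover have "D \<noteq> 0" using x by (force simp: D_def vec_eq_iff)
  moreover have "supp D \<subseteq> S" by (auto simp: supp_def D_def split: if_splits)
  ultimately show ?thesis by blast
qed

section \<open>The lower bound on the support\<close>

text \<open>The only use of coprimality: this is connectedness of the graph of the support, stated for
  blocks that no edge leaves. The mass \<open>|R| m = |C| n\<close> of such a block makes \<open>n\<close> divide \<open>|R|\<close>.\<close>

lemma isolated_block_is_everything:
  fixes A :: "real ^ 'm ^ 'n"
  assumes cop: "coprime CARD('n) CARD('m)" and A: "A \<in> doubly_stochastic"
    and isolated: "\<And>i j. (i, j) \<in> supp A \<Longrightarrow> i \<in> R \<longleftrightarrow> j \<in> C" and "R \<noteq> {}"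
  shows "R = UNIV" "C = UNIV"
proof -
  have "real (card R * CARD('m)) = (\<Sum>i\<in>R. \<Sum>j\<in>UNIV. A $ i $ j)"
    using A by (simp add: doubly_stochastic_def)
  also have "\<dots> = (\<Sum>i\<in>R. \<Sum>j\<in>C. A $ i $ j)"
    using isolated by (intro sum.cong refl sum.mono_neutral_right) (auto simp: supp_def)
  also have "\<dots> = (\<Sum>j\<in>C. \<Sum>i\<in>R. A $ i $ j)" by (rule sum.swap)
  also have "\<dots> = (\<Sum>j\<in>C. \<Sum>i\<in>UNIV. A $ i $ j)"
    using isolated by (intro sum.cong refl sum.mono_neutral_left) (auto simp: supp_def)
  also have "\<dots> = real (card C * CARD('n))"
    using A by (simp add: doubly_stochastic_def)
  finally have mass: "card R * CARD('m) = card C * CARD('n)" by linarith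
  then have "CARD('n) dvd card R * CARD('m)" by simp
  with cop have "CARD('n) dvd card R" by (simp add: coprime_dvd_mult_left_iff)
  moreover have "card R > 0" using \<open>R \<noteq> {}\<close> by (simp add: card_gt_0_iff)
  ultimately have "CARD('n) \<le> card R" by (rule dvd_imp_le)
  then show "R = UNIV" by (intro card_seteq) auto
  with mass have "CARD('m) \<le> card C" by simp
  then show "C = UNIV" by (intro card_seteq) auto
qed

text \<open>With fewer edges, the system of potentials together with the normalisation \<open>u i0 = 0\<close> would
  still have fewer equations than its \<open>n + m\<close> unknowns, so it would have a nonzero solution. But
  the zero level set of such a solution is an isolated block containing \<open>i0\<close>, hence everything.\<close>

lemma card_supp_ge:
  fixes A :: "real ^ 'm ^ 'n"
  assumes cop: "coprime CARD('n) CARD('m)" and A: "A \<in> doubly_stochastic"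
  shows "CARD('n) + CARD('m) - 1 \<le> card (supp A)"
proof (rule ccontr)
  assume less: "\<not> CARD('n) + CARD('m) - 1 \<le> card (supp A)"
  obtain i0 :: 'n where True by simp
  \<comment> \<open>\<open>None\<close> indexes the normalisation, \<open>Some (i, j)\<close> the equation of the edge \<open>(i, j)\<close>.\<close>
  define E where "E = insert None (Some ` supp A)"
  define c :: "('n \<times> 'm) option \<Rightarrow> 'n + 'm \<Rightarrow> real" where
    "c e v = (case e of None \<Rightarrow> of_bool (v = Inl i0)
      | Some (i, j) \<Rightarrow> of_bool (v = Inl i) + of_bool (v = Inr j))" for e v
  have "card E \<le> Suc (card (supp A))"
    unfolding E_def by (subst card_insert_disjoint) (auto simp: card_image)
  then have "card E < card (UNIV :: ('n + 'm) set)" using less by simp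
  from underdetermined_homogeneous_system[OF _ _ this, of c]
  obtain x where x: "\<exists>v. x v \<noteq> 0" and eqs: "\<And>e. e \<in> E \<Longrightarrow> (\<Sum>v\<in>UNIV. c e v * x v) = 0"
    by (auto simp: E_def)
  have x0: "x (Inl i0) = 0" using eqs[of None] by (simp add: E_def c_def)
  have edge: "x (Inl i) + x (Inr j) = 0" if "(i, j) \<in> supp A" for i j
    using eqs[of "Some (i, j)"] that by (simp add: E_def c_def distrib_right sum.distrib)
  have isolated: "i \<in> {i. x (Inl i) = 0} \<longleftrightarrow> j \<in> {j. x (Inr j) = 0}" if "(i, j) \<in> supp A" for i j
    using edge[OF that] by auto
  have "{i. x (Inl i) = 0} \<noteq> {}" using x0 by blast
  with isolated_block_is_everything[OF cop A isolated]
  have "x (Inl i) = 0" "x (Inr j) = 0" for i j by auto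
  then have "x v = 0" for v by (cases v) auto
  with x show False by blast
qed

section \<open>Extremal and minimum arrays\<close>

text \<open>An array of minimum support carries no perturbation, so its support cannot exceed
  \<open>n + m - 1\<close>.\<close>

lemma min_supp_eq:
  assumes cop: "coprime CARD('n::finite) CARD('m::finite)"
  shows "min_supp TYPE('n) TYPE('m) = CARD('n) + CARD('m) - 1"
proof -
  let ?sizes = "(\<lambda>A. card (supp A)) ` (doubly_stochastic :: (real ^ 'm ^ 'n) set)"
  have "Min ?sizes \<in> ?sizes"
    using finite_card_supp_image doubly_stochastic_nonempty by (intro Min_in) auto
  then obtain A :: "real ^ 'm ^ 'n" where A: "A \<in> doubly_stochastic"
    and card_A: "card (supp A) = Min ?sizes"
    by auto
  have "card (supp A) \<le> CARD('n) + CARD('m) - 1"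
  proof (rule ccontr)
    assume "\<not> ?thesis"
    then obtain D :: "real ^ 'm ^ 'n" where D: "D \<in> zero_marginals" "D \<noteq> 0" "supp D \<subseteq> supp A"
      using perturbation_exists[of "supp A"] by auto
    obtain t where B: "A + t *\<^sub>R D \<in> doubly_stochastic" "supp (A + t *\<^sub>R D) \<subset> supp A"
      using shrink_support_along[OF A D] .
    have "card (supp (A + t *\<^sub>R D)) < card (supp A)" using B by (intro psubset_card_mono) auto
    moreover have "Min ?sizes \<le> card (supp (A + t *\<^sub>R D))"
      using B finite_card_supp_image by (intro Min_le) auto
    ultimately show False using card_A by simp
  qed
  with card_supp_ge[OF cop A] card_A show ?thesis by (simp add: min_supp_def)
qed

theorem theorem2:
  fixes M :: "real ^ 'm ^ 'n"
  assumes "coprime CARD('n) CARD('m)"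
    and "M \<in> doubly_stochastic"
  shows "(extremal M \<longleftrightarrow> minimum M) \<and>
         (extremal M \<longleftrightarrow> card (supp M) = CARD('n) + CARD('m) - 1)"
proof -
  have "extremal M \<longleftrightarrow> card (supp M) = CARD('n) + CARD('m) - 1"
  proof
    assume "extremal M"
    then have "\<not> card (supp M) > CARD('n) + CARD('m) - 1"
      using perturbation_exists[of "supp M"] extremal_iff_no_perturbation[OF assms(2)] by blast
    with card_supp_ge[OF assms] show "card (supp M) = CARD('n) + CARD('m) - 1" by simp
  next
    assume card_M: "card (supp M) = CARD('n) + CARD('m) - 1"
    have False if D: "D \<in> zero_marginals" "D \<noteq> 0" "supp D \<subseteq> supp M" for D
    proof -
      obtain t where B: "M + t *\<^sub>R D \<in> doubly_stochastic" "supp (M + t *\<^sub>R D) \<subset> supp M"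
        using shrink_support_along[OF assms(2) D] .
      have "card (supp (M + t *\<^sub>R D)) < card (supp M)" using B by (intro psubset_card_mono) auto
      with card_supp_ge[OF assms(1) B(1)] card_M show False by simp
    qed
    then show "extremal M" using extremal_iff_no_perturbation[OF assms(2)] by blast
  qed
  then show ?thesis using min_supp_eq[OF assms(1)] assms(2) by (simp add: minimum_def)
qed

end
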